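(* For $G\in\mathcal D_{(SL)}$ let $\mathcal M(G)$ be the unique solution of the Lyapunov equation $$\begin{bmatrix}A&0\\ 0&S-GL\end{bmatrix}^T\mathcal M(G)+\mathcal M(G)\begin{bmatrix}A&0\\ 0&S-GL\end{bmatrix}+\begin{bmatrix}C^TC&-C^TC_V\\ -C_V^TC&C_V^TC_V\end{bmatrix}=0,$$ and let $$f(G)=\mathrm{Trace}\left(\begin{bmatrix}B\\ G\end{bmatrix}^T\mathcal M(G)\begin{bmatrix}B\\ G\end{bmatrix}\right).$$ Then $f$ is differentiable on the set $\mathcal D_{(SL)}$ and its gradient at $G\in\mathcal D_{(SL)}$ is $$\nabla f(G)=2\left[-M_{12}^T(G)W_{12}(G)L^T-M_{22}(G)W_{22}(G)L^T+M_{12}^T(G)B+M_{22}(G)G\right],$$ where $\mathcal W(G)$ is the solution of the Lyapunov equation $$\begin{bmatrix}A&0\\ 0&S-GL\end{bmatrix}\mathcal W(G)+\mathcal W(G)\begin{bmatrix}A&0\\ 0&S-GL\end{bmatrix}^T+\begin{bmatrix}B\\ G\end{bmatrix}\begin{bmatrix}B\\ G\end{bmatrix}^T=0.$$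
   Context: Let $A\in\mathbb R^{n\times n}$, $B\in\mathbb R^{n\times m}$, $C\in\mathbb R^{p\times n}$ be a minimal realization of a linear time-invariant system $\dot x=Ax+Bu$, $y=Cx$, with $A$ stable: $\sigma(A)\subset\mathbb C^-$ ($\sigma$ is the spectrum, $\mathbb C^-$ the open left half plane). Fix $S\in\mathbb R^{\nu\times\nu}$ and $L\in\mathbb R^{m\times\nu}$ with the pair $(L,S)$ observable and $\sigma(S)\cap\sigma(A)=\emptyset$, let $\Pi\in\mathbb R^{n\times\nu}$ be the unique solution of the Sylvester equation $A\Pi+BL=\Pi S$, and put $C_V=C\Pi$. The variable is $G\in\mathbb R^{\nu\times m}$ and $\mathcal D_{(SL)}=\{G:\sigma(S-GL)\subset\mathbb C^-\}$. Symmetric $(n+\nu)\times(n+\nu)$ matrices are partitioned as $\mathcal W=\begin{bmatrix}W_{11}&W_{12}\\ W_{12}^T&W_{22}\end{bmatrix}$, $\mathcal M=\begin{bmatrix}M_{11}&M_{12}\\ M_{12}^T&M_{22}\end{bmatrix}$ with $W_{11},M_{11}\in\mathbb R^{n\times n}$ and $W_{22},M_{22}\in\mathbb R^{\nu\times\nu}$. The gradient is defined by $f'(G)\,dG=\mathrm{Trace}(\nabla f(G)^TdG)$ for all $dG\in\mathbb R^{\nu\times m}$. *)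

theory Defs
  imports "HOL-Analysis.Analysis"
begin

definition spec :: "real^'a^'a \<Rightarrow> complex set" where
  "spec X = {z. \<exists>v. v \<noteq> 0 \<and> map_matrix complex_of_real X *v v = z *s v}"

definition stable :: "real^'a^'a \<Rightarrow> bool" where
  "stable X \<longleftrightarrow> spec X \<subseteq> {z. Re z < 0}"

definition transfer_function ::
  "real^'n^'n \<Rightarrow> real^'m^'n \<Rightarrow> real^'n^'p \<Rightarrow> complex \<Rightarrow> complex^'m^'p" where
  "transfer_function A B C s =
     map_matrix complex_of_real C ** matrix_inv (mat s - map_matrix complex_of_real A)
       ** map_matrix complex_of_real B"

definition state_coords_in ::
  "'n set \<Rightarrow> real^'n^'n \<Rightarrow> real^'m^'n \<Rightarrow> real^'n^'p \<Rightarrow> bool" where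
  "state_coords_in I A B C \<longleftrightarrow>
     (\<forall>i j. A $ i $ j \<noteq> 0 \<longrightarrow> i \<in> I \<and> j \<in> I) \<and>
     (\<forall>i k. B $ i $ k \<noteq> 0 \<longrightarrow> i \<in> I) \<and>
     (\<forall>k j. C $ k $ j \<noteq> 0 \<longrightarrow> j \<in> I)"

(* No realization of smaller state dimension has the same transfer function. Dimensions are types,
   so a realization of order r < CARD('n) is represented, after relabelling its states, by matrices
   of the full format that vanish outside a set I of r state coordinates; I = {} is order 0. The
   zero padding leaves the transfer function unchanged and only adds the pole candidate s = 0. *)
definition minimal_realization :: "real^'n^'n \<Rightarrow> real^'m^'n \<Rightarrow> real^'n^'p \<Rightarrow> bool" where
  "minimal_realization A B C \<longleftrightarrow>
     \<not> (\<exists>(I :: 'n set) (A' :: real^'n^'n) (B' :: real^'m^'n) (C' :: real^'n^'p).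
          I \<subset> UNIV \<and> state_coords_in I A' B' C' \<and>
          (\<forall>s. s \<notin> spec A \<union> spec A' \<longrightarrow>
             transfer_function A' B' C' s = transfer_function A B C s))"

(* Observability of w' = S w, y = L w: the output determines the trajectory's initial state. *)
definition observable :: "real^'v^'m \<Rightarrow> real^'v^'v \<Rightarrow> bool" where
  "observable L S \<longleftrightarrow>
     (\<forall>w w' :: real \<Rightarrow> real^'v.
        (\<forall>t\<ge>0. (w has_vector_derivative S *v w t) (at t within {0..})) \<and>
        (\<forall>t\<ge>0. (w' has_vector_derivative S *v w' t) (at t within {0..})) \<and>
        (\<forall>t\<ge>0. L *v w t = L *v w' t) \<longrightarrow> w 0 = w' 0)"

definition block_mat ::
  "real^'n^'n \<Rightarrow> real^'v^'n \<Rightarrow> real^'n^'v \<Rightarrow> real^'v^'v \<Rightarrow> real^('n+'v)^('n+'v)" where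
  "block_mat P Q R T = (\<chi> i j. case i of
       Inl a \<Rightarrow> (case j of Inl b \<Rightarrow> P $ a $ b | Inr b \<Rightarrow> Q $ a $ b)
     | Inr a \<Rightarrow> (case j of Inl b \<Rightarrow> R $ a $ b | Inr b \<Rightarrow> T $ a $ b))"

definition stack :: "real^'m^'n \<Rightarrow> real^'m^'v \<Rightarrow> real^'m^('n+'v)" where
  "stack B G = (\<chi> i. case i of Inl a \<Rightarrow> B $ a | Inr a \<Rightarrow> G $ a)"

definition block12 :: "real^('n::finite+'v::finite)^('n+'v) \<Rightarrow> real^'v^'n" where
  "block12 X = (\<chi> a b. X $ Inl a $ Inr b)"

definition block22 :: "real^('n::finite+'v::finite)^('n+'v) \<Rightarrow> real^'v^'v" where
  "block22 X = (\<chi> a b. X $ Inr a $ Inr b)"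

definition stabilizing :: "real^'v^'v \<Rightarrow> real^'v^'m \<Rightarrow> (real^'m^'v) set" where
  "stabilizing S L = {G. stable (S - G ** L)}"

definition lyapunov_M ::
  "real^'n^'n \<Rightarrow> real^'n^'p \<Rightarrow> real^'v^'p \<Rightarrow> real^'v^'v \<Rightarrow> real^'v^'m \<Rightarrow> real^'m^'v
     \<Rightarrow> real^('n+'v)^('n+'v) \<Rightarrow> bool" where
  "lyapunov_M A C CV S L G M \<longleftrightarrow>
     transpose (block_mat A 0 0 (S - G ** L)) ** M + M ** block_mat A 0 0 (S - G ** L)
     + block_mat (transpose C ** C) (- (transpose C ** CV))
                 (- (transpose CV ** C)) (transpose CV ** CV) = 0"

definition lyapunov_W ::
  "real^'n^'n \<Rightarrow> real^'m^'n \<Rightarrow> real^'v^'v \<Rightarrow> real^'v^'m \<Rightarrow> real^'m^'v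
     \<Rightarrow> real^('n+'v)^('n+'v) \<Rightarrow> bool" where
  "lyapunov_W A B S L G W \<longleftrightarrow>
     block_mat A 0 0 (S - G ** L) ** W + W ** transpose (block_mat A 0 0 (S - G ** L))
     + stack B G ** transpose (stack B G) = 0"

(* Meaningful for stabilizing G, where the Lyapunov equations have exactly one solution. *)
definition sol_M ::
  "real^'n^'n \<Rightarrow> real^'n^'p \<Rightarrow> real^'v^'p \<Rightarrow> real^'v^'v \<Rightarrow> real^'v^'m \<Rightarrow> real^'m^'v
     \<Rightarrow> real^('n+'v)^('n+'v)" where
  "sol_M A C CV S L G = (THE M. lyapunov_M A C CV S L G M)"

definition sol_W ::
  "real^'n^'n \<Rightarrow> real^'m^'n \<Rightarrow> real^'v^'v \<Rightarrow> real^'v^'m \<Rightarrow> real^'m^'v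
     \<Rightarrow> real^('n+'v)^('n+'v)" where
  "sol_W A B S L G = (THE W. lyapunov_W A B S L G W)"

definition objective ::
  "real^'n^'n \<Rightarrow> real^'m^'n \<Rightarrow> real^'n^'p \<Rightarrow> real^'v^'p \<Rightarrow> real^'v^'v \<Rightarrow> real^'v^'m
     \<Rightarrow> real^'m^'v \<Rightarrow> real" where
  "objective A B C CV S L G =
     trace (transpose (stack B G) ** sol_M A C CV S L G ** stack B G)"

definition has_gradient :: "(real^'m^'v \<Rightarrow> real) \<Rightarrow> real^'m^'v \<Rightarrow> real^'m^'v \<Rightarrow> bool" where
  "has_gradient f N G \<longleftrightarrow> (f has_derivative (\<lambda>dG. trace (transpose N ** dG))) (at G)"

end

theory Submission
  imports Defs "HOL-Computational_Algebra.Fundamental_Theorem_Algebra"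
begin

text \<open>
  The Lyapunov operator of a stable matrix has trivial kernel, so both equations are uniquely
  solvable and, by perturbation of an injective linear map, the solution \<open>M\<close> depends continuously
  on \<open>G\<close>. Since \<open>W\<close> solves the equation adjoint to that of \<open>M\<close>, the increment of \<open>f\<close> is an exact
  expression that is bilinear in \<open>M\<close> at the new point and in terms vanishing at \<open>G\<close>; its first
  order part is the derivative, without differentiating \<open>M\<close>. Moving transposes across the trace
  inner product turns it into the gradient.
\<close>

section \<open>Complex eigenvectors of real linear maps, by annihilating polynomials\<close>

text \<open>With \<open>h\<close> equal to \<open>Re\<close> and to \<open>Im\<close> these are the
  real and the imaginary part of p(\<Phi>) x. Working with such pairs replaces a complexification of
  the real space.\<close>

definition orbit_sum :: "(complex \<Rightarrow> real) \<Rightarrow> ('a::real_vector \<Rightarrow> 'a) \<Rightarrow> 'a \<Rightarrow> complex poly \<Rightarrow> 'a" where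
  "orbit_sum h \<Phi> x p = (\<Sum>i\<le>degree p. h (coeff p i) *\<^sub>R (\<Phi> ^^ i) x)"

text \<open>Coefficients beyond the degree are 0, so polynomials of different degrees can be
  compared over one index range.\<close>

lemma orbit_sum_extend:
  assumes "degree p \<le> N" "h 0 = 0"
  shows "orbit_sum h \<Phi> x p = (\<Sum>i\<le>N. h (coeff p i) *\<^sub>R (\<Phi> ^^ i) x)"
  unfolding orbit_sum_def
  by (rule sum.mono_neutral_left) (use assms in \<open>auto simp: coeff_eq_0\<close>)

lemma orbit_sum_pCons_0:
  assumes "linear \<Phi>" "h 0 = 0"
  shows "orbit_sum h \<Phi> x (pCons 0 q) = \<Phi> (orbit_sum h \<Phi> x q)"
proof -
  interpret linear \<Phi> by fact
  have "orbit_sum h \<Phi> x (pCons 0 q) = (\<Sum>i\<le>Suc (degree q). h (coeff (pCons 0 q) i) *\<^sub>R (\<Phi> ^^ i) x)"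
    by (rule orbit_sum_extend) (use assms in \<open>auto simp: degree_pCons_eq_if\<close>)
  also have "\<dots> = (\<Sum>i\<le>degree q. h (coeff q i) *\<^sub>R \<Phi> ((\<Phi> ^^ i) x))"
    unfolding sum.atMost_Suc_shift using assms by simp
  also have "\<dots> = \<Phi> (orbit_sum h \<Phi> x q)"
    by (simp add: orbit_sum_def sum scale)
  finally show ?thesis .
qed

text \<open>Read w = u + i v for q(\<Phi>) x and z = a + i b. The two right-hand sides are the real
  and imaginary parts of \<Phi> w - z w, because X - z acts as \<Phi> - z.\<close>

lemma orbit_sum_linear_factor:
  fixes q :: "complex poly" and a b :: real and x :: "'a::real_vector"
  assumes "linear \<Phi>"
  defines "p \<equiv> [:- Complex a b, 1:] * q"
    and "u \<equiv> orbit_sum Re \<Phi> x q" and "v \<equiv> orbit_sum Im \<Phi> x q"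
  shows "orbit_sum Re \<Phi> x p = \<Phi> u - (a *\<^sub>R u - b *\<^sub>R v)"
    and "orbit_sum Im \<Phi> x p = \<Phi> v - (b *\<^sub>R u + a *\<^sub>R v)"
proof -
  let ?N = "Suc (degree q)"
  have p: "p = pCons 0 q - smult (Complex a b) q"
    by (simp add: p_def)
  have dp: "degree p \<le> ?N"
    unfolding p by (rule order_trans[OF degree_diff_le_max]) (auto simp: degree_pCons_eq_if degree_smult_le le_SucI)
  have dq: "degree (pCons 0 q) \<le> ?N"
    by (auto simp: degree_pCons_eq_if)
  have u: "u = (\<Sum>i\<le>?N. Re (coeff q i) *\<^sub>R (\<Phi> ^^ i) x)"
    unfolding u_def by (rule orbit_sum_extend) auto
  have v: "v = (\<Sum>i\<le>?N. Im (coeff q i) *\<^sub>R (\<Phi> ^^ i) x)"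
    unfolding v_def by (rule orbit_sum_extend) auto
  have Pu: "\<Phi> u = (\<Sum>i\<le>?N. Re (coeff (pCons 0 q) i) *\<^sub>R (\<Phi> ^^ i) x)"
    unfolding u_def orbit_sum_pCons_0[OF assms(1), of Re, simplified, symmetric]
    by (rule orbit_sum_extend) (use dq in auto)
  have Pv: "\<Phi> v = (\<Sum>i\<le>?N. Im (coeff (pCons 0 q) i) *\<^sub>R (\<Phi> ^^ i) x)"
    unfolding v_def orbit_sum_pCons_0[OF assms(1), of Im, simplified, symmetric]
    by (rule orbit_sum_extend) (use dq in auto)
  have "orbit_sum Re \<Phi> x p = (\<Sum>i\<le>?N. Re (coeff p i) *\<^sub>R (\<Phi> ^^ i) x)"
    by (rule orbit_sum_extend) (use dp in auto)
  also have "\<dots> = \<Phi> u - (a *\<^sub>R u - b *\<^sub>R v)"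
    unfolding Pu unfolding u v p scaleR_right.sum sum_subtractf[symmetric]
    by (rule sum.cong) (auto simp: algebra_simps)
  finally show "orbit_sum Re \<Phi> x p = \<Phi> u - (a *\<^sub>R u - b *\<^sub>R v)" .
  have "orbit_sum Im \<Phi> x p = (\<Sum>i\<le>?N. Im (coeff p i) *\<^sub>R (\<Phi> ^^ i) x)"
    by (rule orbit_sum_extend) (use dp in auto)
  also have "\<dots> = \<Phi> v - (b *\<^sub>R u + a *\<^sub>R v)"
    unfolding Pv unfolding u v p scaleR_right.sum sum_subtractf[symmetric] sum.distrib[symmetric]
    by (rule sum.cong) (auto simp: algebra_simps)
  finally show "orbit_sum Im \<Phi> x p = \<Phi> v - (b *\<^sub>R u + a *\<^sub>R v)" .
qed

text \<open>Among the \<open>DIM('a) + 1\<close> iterates x, \<Phi> x, ... there is a linear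
  relation. Its coefficients are real, so the imaginary orbit sum vanishes trivially.\<close>

lemma orbit_annihilating_poly:
  fixes \<Phi> :: "'a::euclidean_space \<Rightarrow> 'a"
  shows "\<exists>p. p \<noteq> 0 \<and> orbit_sum Re \<Phi> x p = 0 \<and> orbit_sum Im \<Phi> x p = 0"
proof -
  let ?N = "DIM('a)" and ?f = "\<lambda>i. (\<Phi> ^^ i) x"
  have "\<exists>c. (\<exists>i\<le>?N. c i \<noteq> 0) \<and> (\<Sum>i\<le>?N. c i *\<^sub>R ?f i) = 0"
  proof (cases "inj_on ?f {..?N}")
    case True
    then have "card (?f ` {..?N}) = Suc ?N"
      by (simp add: card_image)
    then have "dependent (?f ` {..?N})"
      using independent_bound[of "?f ` {..?N}"] by fastforce
    then obtain u where u: "\<exists>v\<in>?f ` {..?N}. u v \<noteq> 0" "(\<Sum>v\<in>?f ` {..?N}. u v *\<^sub>R v) = 0"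
      by (auto simp: dependent_finite)
    show ?thesis
      by (rule exI[of _ "\<lambda>i. u (?f i)"]) (use u in \<open>auto simp: sum.reindex[OF True]\<close>)
  next
    case False
    then obtain i j where ij: "i \<le> ?N" "j \<le> ?N" "i \<noteq> j" "?f i = ?f j"
      by (auto simp: inj_on_def)
    \<comment> \<open>Dependence is a property of sets, where coinciding iterates count once. The
      coincidence itself supplies the relation: iterate i minus iterate j.\<close>
    let ?c = "\<lambda>k. (if k = i then 1 else 0) - (if k = j then 1 else 0) :: real"
    have "(\<Sum>k\<le>?N. ?c k *\<^sub>R ?f k) = (\<Sum>k\<le>?N. if k = i then ?f k else 0) - (\<Sum>k\<le>?N. if k = j then ?f k else 0)"
      unfolding sum_subtractf[symmetric] by (rule sum.cong) (auto simp: algebra_simps)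
    also have "\<dots> = 0"
      using ij by simp
    finally show ?thesis
      by (intro exI[of _ ?c]) (use ij in auto)
  qed
  then obtain c i where c: "i \<le> ?N" "c i \<noteq> 0" "(\<Sum>i\<le>?N. c i *\<^sub>R ?f i) = 0"
    by auto
  define p where "p = (\<Sum>i\<le>?N. monom (complex_of_real (c i)) i)"
  have coeff: "coeff p k = (if k \<le> ?N then of_real (c k) else 0)" for k
    by (simp add: p_def coeff_sum)
  have "degree p \<le> ?N"
    by (rule degree_le) (simp add: coeff)
  then have "orbit_sum Re \<Phi> x p = 0" "orbit_sum Im \<Phi> x p = 0"
    using c by (simp_all add: orbit_sum_extend coeff)
  moreover have "p \<noteq> 0"
    using coeff[of i] c by auto
  ultimately show ?thesis
    by blast
qed

text \<open>Take an annihilating polynomial p of x of least degree and split off a root: p = (X - z)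
  q. By minimality w = q(\<Phi>) x is non-zero, and (\<Phi> - z) w = 0. The conclusion is the real
  form of \<Phi> w = z w with w = u + i v; both parts lie in \<open>K\<close> since all iterates of
  x do.\<close>

lemma invariant_subspace_complex_eigenvector:
  fixes \<Phi> :: "'a::euclidean_space \<Rightarrow> 'a"
  assumes lin: "linear \<Phi>" and K: "subspace K" "\<Phi> ` K \<subseteq> K" and x: "x \<in> K" "x \<noteq> 0"
  obtains a b u v where "u \<in> K" "v \<in> K" "u \<noteq> 0 \<or> v \<noteq> 0"
    "\<Phi> u = a *\<^sub>R u - b *\<^sub>R v" "\<Phi> v = b *\<^sub>R u + a *\<^sub>R v"
proof -
  let ?Ann = "\<lambda>p. p \<noteq> 0 \<and> orbit_sum Re \<Phi> x p = 0 \<and> orbit_sum Im \<Phi> x p = 0"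
  obtain p where p: "?Ann p" and minimal: "\<And>q. ?Ann q \<Longrightarrow> degree p \<le> degree q"
    using ex_has_least_nat[of ?Ann _ degree] orbit_annihilating_poly[of \<Phi> x] by blast
  have "degree p \<noteq> 0"
  proof
    assume "degree p = 0"
    then obtain c where c: "p = [:c:]"
      by (rule degree_eq_zeroE)
    then show False
      using p x by (auto simp: orbit_sum_def complex_eq_iff)
  qed
  then have "\<not> constant (poly p)"
    by (simp add: constant_degree)
  then obtain z where "poly p z = 0"
    using fundamental_theorem_of_algebra by blast
  then obtain q where q: "p = [:- z, 1:] * q"
    by (auto simp: poly_eq_0_iff_dvd)
  have "q \<noteq> 0"
    using p q by auto
  then have "degree p = Suc (degree q)"
    unfolding q by (subst degree_mult_eq) auto
  then have nz: "orbit_sum Re \<Phi> x q \<noteq> 0 \<or> orbit_sum Im \<Phi> x q \<noteq> 0"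
    using minimal[of q] \<open>q \<noteq> 0\<close> by auto
  have "(\<Phi> ^^ i) x \<in> K" for i
    by (induction i) (use K x in auto)
  then have inK: "orbit_sum h \<Phi> x q \<in> K" for h
    unfolding orbit_sum_def by (intro subspace_sum subspace_scale K)
  have q': "p = [:- Complex (Re z) (Im z), 1:] * q"
    using q by simp
  show thesis
    by (rule that[of "orbit_sum Re \<Phi> x q" "orbit_sum Im \<Phi> x q" "Re z" "Im z"])
      (use inK nz p orbit_sum_linear_factor[OF lin, where a = "Re z" and b = "Im z" and q = q and x = x, folded q'] in auto)
qed

section \<open>Spectra and the homogeneous Sylvester equation\<close>

text \<open>Right eigenvectors say nothing directly about the transpose; the determinant does not
  change under transposition.\<close>

lemma spec_iff_det: "z \<in> spec X \<longleftrightarrow> det (map_matrix complex_of_real X - mat z) = 0"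
proof -
  have "map_matrix complex_of_real X *v v = z *s v \<longleftrightarrow> (map_matrix complex_of_real X - mat z) *v v = 0" for v
  proof -
    have "mat z *v v = z *s v"
      by (simp add: vec_eq_iff matrix_vector_mult_def mat_def if_distrib[of "\<lambda>x. x * _"] cong: if_cong)
    then show ?thesis
      by (simp add: matrix_vector_mult_diff_rdistrib)
  qed
  then have "z \<in> spec X \<longleftrightarrow> \<not> (\<exists>B. B ** (map_matrix complex_of_real X - mat z) = mat 1)"
    unfolding spec_def matrix_left_invertible_ker by auto
  also have "\<dots> \<longleftrightarrow> \<not> invertible (map_matrix complex_of_real X - mat z)"
    by (simp add: invertible_left_inverse)
  finally show ?thesis
    by (simp add: invertible_det_nz)
qed

lemma spec_transpose: "spec (transpose X) = spec X"
proof -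
  have "map_matrix complex_of_real (transpose X) - mat z
      = transpose (map_matrix complex_of_real X - mat z)" for z
    by (auto simp: vec_eq_iff transpose_def mat_def map_matrix_def)
  then show ?thesis
    by (auto simp: spec_iff_det)
qed

lemma stable_transpose: "stable (transpose X) \<longleftrightarrow> stable X"
  by (simp add: stable_def spec_transpose)

text \<open>The hypotheses say Y (U + i V) = (a + i b) (U + i V). This holds column by column, so
  any non-zero column of U + i V is an eigenvector.\<close>

lemma eigenvalue_from_real_pair:
  fixes Y :: "real^'n^'n" and U V :: "real^'k^'n"
  assumes nz: "U \<noteq> 0 \<or> V \<noteq> 0"
    and YU: "Y ** U = a *\<^sub>R U - b *\<^sub>R V" and YV: "Y ** V = b *\<^sub>R U + a *\<^sub>R V"
  shows "Complex a b \<in> spec Y"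
proof -
  obtain i j where ij: "U $ i $ j \<noteq> 0 \<or> V $ i $ j \<noteq> 0"
    using nz by (auto simp: vec_eq_iff)
  let ?w = "\<chi> i. Complex (U $ i $ j) (V $ i $ j)"
  have "(map_matrix complex_of_real Y *v ?w) $ k = (Complex a b *s ?w) $ k" for k
  proof -
    have "(\<Sum>l\<in>UNIV. Y $ k $ l * U $ l $ j) = a * U $ k $ j - b * V $ k $ j"
         "(\<Sum>l\<in>UNIV. Y $ k $ l * V $ l $ j) = b * U $ k $ j + a * V $ k $ j"
      using arg_cong[OF YU, of "\<lambda>M. M $ k $ j"] arg_cong[OF YV, of "\<lambda>M. M $ k $ j"]
      by (simp_all add: matrix_matrix_mult_def)
    then show ?thesis
      by (simp add: matrix_vector_mult_def map_matrix_def complex_eq_iff)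
  qed
  then have "map_matrix complex_of_real Y *v ?w = Complex a b *s ?w"
    by (simp add: vec_eq_iff)
  moreover have "?w \<noteq> 0"
    using ij by (auto simp: vec_eq_iff complex_eq_iff)
  ultimately show ?thesis
    unfolding spec_def by blast
qed

lemma matrix_diff_distrib:
  fixes X Y :: "real^'n^'m" and Z W :: "real^'k^'n"
  shows "(X - Y) ** Z = X ** Z - Y ** Z" "X ** (Z - W) = X ** Z - X ** W"
  by (simp_all add: vec_eq_iff matrix_matrix_mult_def sum_subtractf algebra_simps)

lemma matrix_add_rdistrib: "(X + Y) ** Z = X ** Z + Y ** Z"
  for X Y :: "real^'n^'m" and Z :: "real^'k^'n"
  by (simp add: vec_eq_iff matrix_matrix_mult_def sum.distrib algebra_simps)

lemma matrix_minus_distrib: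
  fixes X :: "real^'n^'m" and Z :: "real^'k^'n"
  shows "(- X) ** Z = - (X ** Z)" "X ** (- Z) = - (X ** Z)"
  by (simp_all add: vec_eq_iff matrix_matrix_mult_def sum_negf)

lemma transpose_add: "transpose (X + Y) = transpose X + transpose Y"
  and transpose_diff: "transpose (X - Y) = transpose X - transpose Y"
  and transpose_minus: "transpose (- X) = - transpose X"
  and transpose_zero: "transpose 0 = 0"
  for X Y :: "real^'n^'m"
  by (simp_all add: vec_eq_iff transpose_def)

lemma matrix_mult_scaleR:
  fixes X :: "real^'n^'m" and Z :: "real^'k^'n"
  shows "(c *\<^sub>R X) ** Z = c *\<^sub>R (X ** Z)" "X ** (c *\<^sub>R Z) = c *\<^sub>R (X ** Z)"
  by (simp_all add: vec_eq_iff matrix_matrix_mult_def sum_distrib_left mult_ac)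

lemma matrix_mult_zero:
  fixes X :: "real^'n^'m"
  shows "(0 :: real^'m^'k) ** X = 0" "X ** (0 :: real^'k^'n) = 0"
  by (simp_all add: vec_eq_iff matrix_matrix_mult_def)

(* The kernel of U \<mapsto> Y U + U X is invariant under U \<mapsto> Y U, and a complex eigenvector U of the
   latter in this kernel satisfies Y U = z U and U X = - z U. *)
lemma sylvester_kernel_trivial:
  fixes Y :: "real^'n^'n" and X :: "real^'k^'k" and M :: "real^'k^'n"
  assumes disj: "\<And>z. z \<in> spec Y \<Longrightarrow> - z \<notin> spec X" and M: "Y ** M + M ** X = 0"
  shows "M = 0"
proof (rule ccontr)
  assume "M \<noteq> 0"
  define K where "K = {U :: real^'k^'n. U ** X = - (Y ** U)}"
  have "linear (\<lambda>U :: real^'k^'n. Y ** U)"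
    by (rule linearI) (simp_all add: matrix_add_ldistrib matrix_mult_scaleR)
  moreover have "subspace K"
    by (auto simp: subspace_def K_def matrix_mult_zero matrix_add_ldistrib matrix_add_rdistrib
        matrix_mult_scaleR)
  moreover have "(\<lambda>U. Y ** U) ` K \<subseteq> K"
    by (auto simp: K_def matrix_mul_assoc[symmetric] matrix_minus_distrib)
  moreover have "M \<in> K"
    using M by (simp add: K_def eq_neg_iff_add_eq_0 add.commute)
  ultimately obtain a b U V where UV: "U \<in> K" "V \<in> K" "U \<noteq> 0 \<or> V \<noteq> 0"
    "Y ** U = a *\<^sub>R U - b *\<^sub>R V" "Y ** V = b *\<^sub>R U + a *\<^sub>R V"
    using \<open>M \<noteq> 0\<close> by (rule invariant_subspace_complex_eigenvector)
  have Y: "Complex a b \<in> spec Y"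
    by (rule eigenvalue_from_real_pair[OF UV(3-5)])
  \<comment> \<open>Membership in \<open>K\<close> makes the non-zero rows of U + i V left
    eigenvectors of \<open>X\<close> for the negated eigenvalue, hence the passage to the
    transpose.\<close>
  have "Complex (- a) (- b) \<in> spec (transpose X)"
  proof (rule eigenvalue_from_real_pair[of "transpose U" "transpose V"])
    show "transpose U \<noteq> 0 \<or> transpose V \<noteq> 0"
      using UV(3) transpose_iff[of U 0] transpose_iff[of V 0] by (auto simp: transpose_zero)
    have UX: "U ** X = - (a *\<^sub>R U - b *\<^sub>R V)" "V ** X = - (b *\<^sub>R U + a *\<^sub>R V)"
      using UV(1,2) unfolding K_def UV(4,5)[symmetric] by simp_all
    show "transpose X ** transpose U = (- a) *\<^sub>R transpose U - (- b) *\<^sub>R transpose V"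
      "transpose X ** transpose V = (- b) *\<^sub>R transpose U + (- a) *\<^sub>R transpose V"
      unfolding matrix_transpose_mul[symmetric] UX
      by (simp_all add: transpose_minus transpose_add transpose_diff transpose_scalar)
  qed
  then have "- Complex a b \<in> spec X"
    by (simp add: spec_transpose uminus_complex.code)
  then show False
    using disj[OF Y] by blast
qed

text \<open>Negation sends the open left half plane to the open right one, so no eigenvalue of
  \<open>Y\<close> is the negative of one of \<open>X\<close>.\<close>

lemma stable_sylvester_kernel_trivial:
  fixes Y :: "real^'n^'n" and X :: "real^'k^'k" and M :: "real^'k^'n"
  assumes "stable Y" "stable X" "Y ** M + M ** X = 0"
  shows "M = 0"
  by (rule sylvester_kernel_trivial[OF _ assms(3)]) (use assms(1,2) in \<open>force simp: stable_def\<close>)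

lemma sum_over_sum_type:
  "(\<Sum>i\<in>(UNIV :: ('a::finite + 'b::finite) set). f i) = (\<Sum>i\<in>UNIV. f (Inl i)) + (\<Sum>i\<in>UNIV. f (Inr i))"
  by (simp add: UNIV_Plus_UNIV[symmetric] sum.Plus del: UNIV_Plus_UNIV)

text \<open>The upper and the lower part of an eigenvector satisfy the eigenvalue equations of
  \<open>A\<close> and \<open>F\<close> separately, and at least one part is non-zero.\<close>

lemma stable_block_diag:
  fixes A :: "real^'n^'n" and F :: "real^'v^'v"
  assumes "stable A" "stable F"
  shows "stable (block_mat A 0 0 F)"
  unfolding stable_def
proof
  fix z assume "z \<in> spec (block_mat A 0 0 F)"
  then obtain w where w: "w \<noteq> 0" "map_matrix complex_of_real (block_mat A 0 0 F) *v w = z *s w"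
    by (auto simp: spec_def)
  let ?x = "\<chi> i. w $ Inl i" and ?y = "\<chi> i. w $ Inr i"
  have "map_matrix complex_of_real A *v ?x = z *s ?x"
    using arg_cong[OF w(2), of "\<lambda>u. u $ Inl _"]
    by (simp add: vec_eq_iff matrix_vector_mult_def map_matrix_def sum_over_sum_type block_mat_def)
  moreover have "map_matrix complex_of_real F *v ?y = z *s ?y"
    using arg_cong[OF w(2), of "\<lambda>u. u $ Inr _"]
    by (simp add: vec_eq_iff matrix_vector_mult_def map_matrix_def sum_over_sum_type block_mat_def)
  moreover have "?x \<noteq> 0 \<or> ?y \<noteq> 0"
  proof (rule ccontr)
    assume "\<not> (?x \<noteq> 0 \<or> ?y \<noteq> 0)"
    then have "w $ i = 0" for i
      by (cases i) (auto simp: vec_eq_iff)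
    with w(1) show False
      by (simp add: vec_eq_iff)
  qed
  ultimately have "z \<in> spec A \<union> spec F"
    by (auto simp: spec_def)
  then show "z \<in> {z. Re z < 0}"
    using assms by (auto simp: stable_def)
qed

section \<open>Derivatives through a linear equation that depends on a parameter\<close>

lemma ex1_linear_inj:
  fixes T :: "'a::euclidean_space \<Rightarrow> 'a"
  assumes "linear T" "inj T"
  shows "\<exists>!x. T x = y"
  using linear_injective_imp_surjective[OF assms] assms(2) by (metis injD surjD)

text \<open>A product rule in which \<open>u\<close> is merely continuous. Split off
  \<open>p (u g) (v y)\<close>: the rest \<open>p (u y - u g) (v y)\<close> is o(|y - g|), because
  its first factor tends to 0 and its second is O(|y - g|).\<close>

lemma has_derivative_bilinear_vanishing_factor:
  assumes p: "bounded_bilinear p" and u: "isCont u g"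
    and v: "(v has_derivative v') (at g)" "v g = 0"
  shows "((\<lambda>y. p (u y) (v y)) has_derivative (\<lambda>h. p (u g) (v' h))) (at g)"
proof -
  interpret p: bounded_bilinear p by fact
  let ?e = "\<lambda>y. norm ((v y - v g) - v' (y - g)) / norm (y - g)"
  obtain K where K: "K > 0" "\<And>a b. norm (p a b) \<le> norm a * norm b * K"
    using p.pos_bounded by blast
  obtain C where C: "C > 0" "\<And>h. norm (v' h) \<le> norm h * C"
    using bounded_linear.pos_bounded[OF has_derivative_bounded_linear[OF v(1)]] by blast
  have e: "(?e \<longlongrightarrow> 0) (at g)"
    using v(1) by (simp add: has_derivative_iff_norm)
  \<comment> \<open>Linear growth of \<open>v\<close> at its zero \<open>g\<close>, with the
    remainder quotient \<open>?e\<close> in the constant. At \<open>y = g\<close> the quotient is 0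
    by the convention on division, and both sides are 0.\<close>
  have "norm (v y) \<le> (C + ?e y) * norm (y - g)" for y
  proof -
    have "norm (v y) \<le> norm (v' (y - g)) + norm ((v y - v g) - v' (y - g))"
      using v(2) norm_triangle_ineq[of "v' (y - g)" "v y - v' (y - g)"] by simp
    also have "norm ((v y - v g) - v' (y - g)) = ?e y * norm (y - g)"
      using v(2) linear_0[OF has_derivative_linear[OF v(1)]] by (cases "y = g") auto
    finally show ?thesis
      using C(2)[of "y - g"] by (simp add: algebra_simps)
  qed
  moreover have "norm (p (u y - u g) (v y)) \<le> norm (u y - u g) * norm (v y) * K" for y
    by (rule K)
  ultimately have "norm (p (u y - u g) (v y)) \<le> norm (u y - u g) * ((C + ?e y) * norm (y - g)) * K" for y
    using K(1) by (meson less_imp_le mult_left_mono mult_right_mono norm_ge_zero order_trans)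
  then have bound: "norm (p (u y - u g) (v y)) / norm (y - g) \<le> norm (u y - u g) * (C + ?e y) * K"
    if "y \<noteq> g" for y
    using that by (subst pos_divide_le_eq) (simp_all only: zero_less_norm_iff right_minus_eq mult_ac not_False_eq_True)
  have "((\<lambda>y. norm (u y - u g) * (C + ?e y) * K) \<longlongrightarrow> norm (u g - u g) * (C + 0) * K) (at g)"
    by (intro tendsto_intros e u[unfolded isCont_def])
  then have lim: "((\<lambda>y. norm (u y - u g) * (C + ?e y) * K) \<longlongrightarrow> 0) (at g)"
    by simp
  have "\<forall>\<^sub>F y in at g. norm (norm (p (u y - u g) (v y)) / norm (y - g)) \<le> norm (u y - u g) * (C + ?e y) * K"
    using eventually_neq_at_within[of g g UNIV]
  proof (rule eventually_mono)
    fix y assume "y \<noteq> g"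
    from bound[OF this]
    show "norm (norm (p (u y - u g) (v y)) / norm (y - g)) \<le> norm (u y - u g) * (C + ?e y) * K"
      by (simp only: real_norm_def abs_divide abs_norm_cancel)
  qed
  then have "((\<lambda>y. norm (p (u y - u g) (v y)) / norm (y - g)) \<longlongrightarrow> 0) (at g)"
    using lim by (rule Lim_null_comparison)
  then have "((\<lambda>y. p (u y - u g) (v y)) has_derivative (\<lambda>h. 0)) (at g)"
    by (simp add: has_derivative_iff_norm p.zero_left)
  moreover have "((\<lambda>y. p (u g) (v y)) has_derivative (\<lambda>h. p (u g) (v' h))) (at g)"
    by (rule bounded_linear.has_derivative[OF p.bounded_linear_right v(1)])
  ultimately have "((\<lambda>y. p (u y - u g) (v y) + p (u g) (v y)) has_derivative (\<lambda>h. 0 + p (u g) (v' h))) (at g)"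
    by (rule has_derivative_add)
  then show ?thesis
    by (simp add: p.diff_left)
qed

text \<open>An injective linear map in finite dimension is bounded below by some c > 0, and a small
  perturbation keeps the bound c / 2. This gives injectivity near \<open>g\<close> and also bounds
  all nearby solutions by 2 |q| / c.\<close>

lemma perturbed_linear_equation:
  fixes T :: "'g::real_normed_vector \<Rightarrow> 'a::euclidean_space \<Rightarrow> 'a"
  assumes lin: "\<And>h. linear (T h)" and inj: "inj (T g)" and b: "bounded_bilinear \<beta>"
    and Tb: "\<And>h x. T h x = T g x + \<beta> (h - g) x"
  shows "\<forall>\<^sub>F h in nhds g. inj (T h)"
    and "(\<And>h. inj (T h) \<Longrightarrow> T h (X h) = q) \<Longrightarrow> isCont X g"
proof -
  obtain c where c: "c > 0" "\<And>x. c * norm x \<le> norm (T g x)"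
    using linear_inj_bounded_below_pos[OF lin inj] by blast
  obtain K where K: "K > 0" "\<And>a b. norm (\<beta> a b) \<le> norm a * norm b * K"
    using bounded_bilinear.pos_bounded[OF b] by blast
  \<comment> \<open>The radius c / (2 K) is where the perturbation can consume at most half of the
    lower bound.\<close>
  have below: "c / 2 * norm x \<le> norm (T h x)" if "dist h g < c / (2 * K)" for h x
  proof -
    have "norm (\<beta> (h - g) x) \<le> norm (h - g) * K * norm x"
      using K(2)[of "h - g" x] by (simp add: mult_ac)
    also have "\<dots> \<le> c / 2 * norm x"
      using that K(1) by (intro mult_right_mono) (auto simp: dist_norm field_simps)
    finally have "norm (\<beta> (h - g) x) \<le> c / 2 * norm x" .
    moreover have "norm (T g x) \<le> norm (T h x) + norm (\<beta> (h - g) x)"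
      using norm_triangle_ineq4[of "T h x" "\<beta> (h - g) x"] Tb[of h x] by simp
    ultimately show ?thesis
      using c(2)[of x] by simp
  qed
  have near: "\<forall>\<^sub>F h in nhds g. dist h g < c / (2 * K)"
    using c(1) K(1) unfolding eventually_nhds_metric by (intro exI[of _ "c / (2 * K)"]) auto
  have inj': "inj (T h)" if "dist h g < c / (2 * K)" for h
    unfolding linear_injective_0[OF lin]
  proof (intro allI impI)
    fix x assume "T h x = 0"
    then show "x = 0"
      using below[OF that, of x] c(1) by (simp add: mult_le_0_iff)
  qed
  with near show "\<forall>\<^sub>F h in nhds g. inj (T h)"
    by (rule eventually_mono)
  assume X: "\<And>h. inj (T h) \<Longrightarrow> T h (X h) = q"
  have "norm (X h - X g) \<le> norm (h - g) * (2 * norm q / c) * K / c" if h: "dist h g < c / (2 * K)" for h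
  proof -
    \<comment> \<open>The equations at \<open>h\<close> and at \<open>g\<close> have the same
      right-hand side, so their difference bounds \<open>X h - X g\<close> linearly in
      \<open>h - g\<close>.\<close>
    have "T g (X h - X g) = - \<beta> (h - g) (X h)"
      using X[OF inj] X[OF inj'[OF h]] Tb[of h "X h"] by (simp add: linear_diff[OF lin] algebra_simps)
    then have "c * norm (X h - X g) \<le> norm (\<beta> (h - g) (X h))"
      using c(2)[of "X h - X g"] by simp
    also have "\<dots> \<le> norm (h - g) * norm (X h) * K"
      by (rule K)
    also have "\<dots> \<le> norm (h - g) * (2 * norm q / c) * K"
      using below[OF h, of "X h"] X[OF inj'[OF h]] c(1) K(1)
      by (intro mult_right_mono mult_left_mono) (auto simp: field_simps)
    finally show ?thesis
      using c(1) by (simp add: field_simps)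
  qed
  then have "\<forall>\<^sub>F h in at g. norm (X h - X g) \<le> norm (h - g) * (2 * norm q / c) * K / c"
    using near by (auto simp: eventually_nhds_conv_at elim!: eventually_mono)
  moreover have "((\<lambda>h. norm (h - g) * (2 * norm q / c) * K / c) \<longlongrightarrow> norm (g - g) * (2 * norm q / c) * K / c) (at g)"
    using c(1) by (intro tendsto_intros) auto
  ultimately have "((\<lambda>h. X h - X g) \<longlongrightarrow> 0) (at g)"
    by (auto intro: Lim_null_comparison)
  then show "isCont X g"
    by (simp add: isCont_def LIM_zero_iff)
qed

(* The adjoint method: with the adjoint state w the increment of X h \<bullet> r h is
   X h \<bullet> (r h - r g) - \<beta> (h - g) (X h) \<bullet> w exactly, so that only continuity of X is needed. *)
lemma has_derivative_adjoint_state: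
  fixes T :: "'g::real_normed_vector \<Rightarrow> 'a::euclidean_space \<Rightarrow> 'a"
  assumes lin: "\<And>h. linear (T h)" and inj: "inj (T g)" and b: "bounded_bilinear \<beta>"
    and Tb: "\<And>h x. T h x = T g x + \<beta> (h - g) x"
    and X: "\<And>h. inj (T h) \<Longrightarrow> T h (X h) = q"
    and r: "(r has_derivative r') (at g)"
    and w: "\<And>x. T g x \<bullet> w = x \<bullet> r g"
  shows "((\<lambda>h. X h \<bullet> r h) has_derivative (\<lambda>h. X g \<bullet> r' h - \<beta> h (X g) \<bullet> w)) (at g)"
proof -
  have cont: "isCont X g"
    by (rule perturbed_linear_equation(2)[OF lin inj b Tb X])
  have r0: "((\<lambda>h. r h - r g) has_derivative r') (at g)"
    using has_derivative_diff[OF r has_derivative_const[of "r g"]] by simp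
  have p1: "((\<lambda>h. X h \<bullet> (r h - r g)) has_derivative (\<lambda>h. X g \<bullet> r' h)) (at g)"
    by (rule has_derivative_bilinear_vanishing_factor[OF bounded_bilinear_inner cont r0]) simp
  have id0: "((\<lambda>h. h - g) has_derivative (\<lambda>h. h)) (at g)"
    using has_derivative_diff[OF has_derivative_ident has_derivative_const[of g]] by simp
  have p2: "((\<lambda>h. \<beta> (h - g) (X h) \<bullet> w) has_derivative (\<lambda>h. \<beta> h (X g) \<bullet> w)) (at g)"
    by (rule has_derivative_inner_left,
        rule has_derivative_bilinear_vanishing_factor[OF bounded_bilinear.flip[OF b] cont id0]) simp
  have eq: "X g \<bullet> r g + X h \<bullet> (r h - r g) - \<beta> (h - g) (X h) \<bullet> w = X h \<bullet> r h" if "inj (T h)" for h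
  proof -
    have "(X h - X g) \<bullet> r g = T g (X h - X g) \<bullet> w"
      by (simp add: w)
    also have "T g (X h - X g) = - \<beta> (h - g) (X h)"
      using X[OF inj] X[OF that] Tb[of h "X h"] by (simp add: linear_diff[OF lin] algebra_simps)
    finally show ?thesis
      by (simp add: inner_diff_left inner_diff_right)
  qed
  have "((\<lambda>h. X g \<bullet> r g + X h \<bullet> (r h - r g) - \<beta> (h - g) (X h) \<bullet> w) has_derivative
      (\<lambda>h. X g \<bullet> r' h - \<beta> h (X g) \<bullet> w)) (at g)"
    using has_derivative_diff[OF has_derivative_add[OF has_derivative_const p1] p2] by simp
  \<comment> \<open>The identity is available where \<open>T h\<close> is injective, thus on a
    neighbourhood of \<open>g\<close>, which determines the derivative.\<close>
  moreover have "\<forall>\<^sub>F h in nhds g. X g \<bullet> r g + X h \<bullet> (r h - r g) - \<beta> (h - g) (X h) \<bullet> w = X h \<bullet> r h"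
    using perturbed_linear_equation(1)[OF lin inj b Tb] by (rule eventually_mono) (rule eq)
  then have "\<forall>\<^sub>F h in at g. X g \<bullet> r g + X h \<bullet> (r h - r g) - \<beta> (h - g) (X h) \<bullet> w = X h \<bullet> r h"
    by (simp add: eventually_nhds_conv_at)
  ultimately show ?thesis
    by (rule has_derivative_transform_eventually) (simp_all add: bounded_bilinear.zero_left[OF b])
qed

section \<open>The trace inner product and the Lyapunov operator\<close>

text \<open>Identifies the trace pairing that defines the gradient with the Euclidean inner product
  of matrices, where adjoints can be taken.\<close>

lemma inner_eq_trace: "X \<bullet> Y = trace (transpose X ** Y)"
  for X Y :: "real^'n^'m"
  unfolding inner_vec_def trace_def matrix_matrix_mult_def transpose_def
  by (subst sum.swap) simp

lemma inner_matrix_mult_left: "(Z ** X) \<bullet> Y = X \<bullet> (transpose Z ** Y)"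
  for X :: "real^'n^'m" and Z :: "real^'m^'k"
  by (simp add: inner_eq_trace matrix_transpose_mul matrix_mul_assoc)

lemma inner_transpose: "transpose X \<bullet> Y = X \<bullet> transpose Y"
  for X :: "real^'n^'m"
  unfolding inner_vec_def transpose_def by (subst sum.swap) simp

lemma inner_matrix_mult_right: "(X ** Z) \<bullet> Y = X \<bullet> (Y ** transpose Z)"
  for X :: "real^'n^'m" and Z :: "real^'k^'n"
  using inner_matrix_mult_left[of "transpose Z" "transpose X" "transpose Y"]
  by (metis inner_transpose matrix_transpose_mul transpose_transpose)

definition lyap :: "real^'k^'k \<Rightarrow> real^'k^'k \<Rightarrow> real^'k^'k" where
  "lyap F M = transpose F ** M + M ** F"

lemma bounded_bilinear_lyap: "bounded_bilinear lyap"
  unfolding bilinear_conv_bounded_bilinear[symmetric] bilinear_def lyap_def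
  by (auto intro!: linearI simp: transpose_add transpose_scalar matrix_add_ldistrib
      matrix_add_rdistrib matrix_mult_scaleR algebra_simps)

lemmas lyap_add_left = bounded_bilinear.add_left[OF bounded_bilinear_lyap]

lemma linear_lyap: "linear (lyap F)"
  by (rule bounded_linear.linear[OF bounded_bilinear.bounded_linear_right[OF bounded_bilinear_lyap]])

lemma inj_lyap: "stable F \<Longrightarrow> inj (lyap F)"
  by (auto simp: linear_injective_0[OF linear_lyap] lyap_def stable_transpose
      intro: stable_sylvester_kernel_trivial[of "transpose F" F])

lemma transpose_lyap: "transpose (lyap F M) = lyap F (transpose M)"
  by (simp add: lyap_def transpose_add matrix_transpose_mul add.commute)

text \<open>The adjoint operator belongs to the transposed matrix; it is the operator in the
  equation for \<open>W\<close>.\<close>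

lemma lyap_inner: "lyap F X \<bullet> Y = X \<bullet> lyap (transpose F) Y"
  by (simp add: lyap_def inner_add_left inner_add_right
      inner_matrix_mult_left[of "transpose F" X Y] inner_matrix_mult_right[of X F Y])

text \<open>The transpose of a solution solves the same equation, so uniqueness forces
  symmetry.\<close>

lemma lyap_symmetric:
  assumes "inj (lyap F)" "lyap F M = Q" "transpose Q = Q"
  shows "transpose M = M"
  using assms by (metis injD transpose_lyap)

text \<open>The two summands of \<open>lyap E M\<close> are transposes of each other, so they pair
  equally with a symmetric \<open>W\<close>.\<close>

lemma lyap_inner_symmetric:
  assumes "transpose M = M" "transpose W = W"
  shows "lyap E M \<bullet> W = 2 * (E \<bullet> (M ** W))"
proof -
  have "(transpose E ** M) \<bullet> W = transpose (transpose E ** M) \<bullet> W"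
    by (simp add: inner_transpose assms)
  then show ?thesis
    by (simp add: lyap_def inner_add_left matrix_transpose_mul inner_matrix_mult_left assms)
qed

section \<open>Block matrices and their dependence on the variable\<close>

lemma transpose_block_mat:
  "transpose (block_mat P Q R T) = block_mat (transpose P) (transpose R) (transpose Q) (transpose T)"
  by (auto simp: vec_eq_iff transpose_def block_mat_def split: sum.split)

lemma stack_add: "stack (B + B') (G + G') = stack B G + stack B' G'"
  by (auto simp: vec_eq_iff stack_def split: sum.split)

lemma bounded_linear_stack_0: "bounded_linear (stack (0 :: real^'m^'n) :: real^'m^'v \<Rightarrow> _)"
  unfolding linear_conv_bounded_linear[symmetric]
  by (rule linearI) (auto simp: vec_eq_iff stack_def split: sum.split)

lemma has_derivative_stack: "(stack B has_derivative stack 0) (at G)"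
proof -
  have "stack B = (\<lambda>G. stack B 0 + stack 0 G)"
    using stack_add[of B 0 0] by auto
  moreover have "((\<lambda>G. stack B 0 + stack 0 G) has_derivative stack 0) (at G)"
    using has_derivative_add[OF has_derivative_const
        bounded_linear.has_derivative[OF bounded_linear_stack_0 has_derivative_ident]]
    by simp
  ultimately show ?thesis
    by (rule ssubst[where P = "\<lambda>f. (f has_derivative _) _"])
qed

lemma bounded_bilinear_outer: "bounded_bilinear (\<lambda>X Y :: real^'m^'k. X ** transpose Y)"
  unfolding bilinear_conv_bounded_bilinear[symmetric] bilinear_def
  by (auto intro!: linearI simp: transpose_add transpose_scalar matrix_add_ldistrib
      matrix_add_rdistrib matrix_mult_scaleR)

text \<open>Only the lower block row of \<open>M\<close> meets \<open>stack 0 H\<close>, and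
  symmetry turns its left block into the transpose of \<open>block12 M\<close>. This yields the
  gradient terms with \<open>B\<close> and \<open>G\<close>.\<close>

lemma mult_stack_inner_stack_0:
  fixes M :: "real^('n::finite+'v::finite)^('n+'v)"
  assumes "transpose M = M"
  shows "(M ** stack B G) \<bullet> stack 0 H = (transpose (block12 M) ** B + block22 M ** G) \<bullet> H"
proof -
  have "M $ Inr a $ Inl b = M $ Inl b $ Inr a" for a b
    using arg_cong[OF assms, of "\<lambda>M. M $ Inl b $ Inr a"] by (simp add: transpose_def)
  then show ?thesis
    by (simp add: inner_vec_def sum_over_sum_type stack_def matrix_matrix_mult_def
        block12_def block22_def transpose_def)
qed

lemma block22_mult:
  fixes M :: "real^('n::finite+'v::finite)^('n+'v)"
  assumes "transpose M = M"
  shows "block22 (M ** W) = transpose (block12 M) ** block12 W + block22 M ** block22 W"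
proof -
  have "M $ Inr a $ Inl b = M $ Inl b $ Inr a" for a b
    using arg_cong[OF assms, of "\<lambda>M. M $ Inl b $ Inr a"] by (simp add: transpose_def)
  then show ?thesis
    by (simp add: vec_eq_iff sum_over_sum_type matrix_matrix_mult_def
        block12_def block22_def transpose_def)
qed

lemma block_mat_inner_lower: "block_mat 0 0 0 T \<bullet> Z = T \<bullet> block22 Z"
  by (simp add: inner_vec_def sum_over_sum_type block_mat_def block22_def)

text \<open>The system matrix is affine in the variable, so the perturbation of the Lyapunov
  operator is exactly bilinear.\<close>

lemma block_mat_perturb:
  "block_mat A 0 0 (S - H ** L) = block_mat A 0 0 (S - G ** L) + block_mat 0 0 0 (- ((H - G) ** L))"
  by (auto simp: vec_eq_iff block_mat_def matrix_diff_distrib split: sum.split)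

lemma bounded_linear_perturbation: "bounded_linear (\<lambda>H :: real^'m^'v. block_mat 0 0 0 (- (H ** L)))"
  unfolding linear_conv_bounded_linear[symmetric]
  by (rule linearI)
    (auto simp: vec_eq_iff block_mat_def matrix_add_rdistrib matrix_mult_scaleR split: sum.split)

section \<open>Assembly of the gradient\<close>

theorem theorem3p9:
  fixes A :: "real^'n^'n" and B :: "real^'m^'n" and C :: "real^'n^'p"
    and S :: "real^'v^'v" and L :: "real^'v^'m"
    and P :: "real^'v^'n" and CV :: "real^'v^'p"
  assumes "minimal_realization A B C"
    and "stable A"
    and "observable L S"
    and "spec S \<inter> spec A = {}"
    and "A ** P + B ** L = P ** S"
    and "CV = C ** P"
  shows "(\<forall>G \<in> stabilizing S L. \<exists>!M. lyapunov_M A C CV S L G M) \<and>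
    (\<forall>G \<in> stabilizing S L. \<exists>!W. lyapunov_W A B S L G W) \<and>
    (\<forall>G \<in> stabilizing S L. objective A B C CV S L differentiable (at G)) \<and>
    (\<forall>G \<in> stabilizing S L.
      let M = sol_M A C CV S L G; W = sol_W A B S L G in
      has_gradient (objective A B C CV S L)
        (2 *\<^sub>R (- (transpose (block12 M) ** block12 W ** transpose L)
                - block22 M ** block22 W ** transpose L
                + transpose (block12 M) ** B
                + block22 M ** G)) G)"
proof -
  define F where "F G = block_mat A 0 0 (S - G ** L)" for G
  define Q where "Q = block_mat (transpose C ** C) (- (transpose C ** CV))
                 (- (transpose CV ** C)) (transpose CV ** CV)"
  \<comment> \<open>This matrix plays two roles: it is the source term in the equation for
    \<open>W\<close>, and it pairs with \<open>M\<close> to give the objective.\<close>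
  define r where "r G = stack B G ** transpose (stack B G)" for G :: "real^'m^'v"
  define E where "E H = (block_mat 0 0 0 (- (H ** L)) :: real^('n+'v)^('n+'v))" for H
  have lyap_M: "lyapunov_M A C CV S L G M \<longleftrightarrow> lyap (F G) M = - Q" for G M
    unfolding lyapunov_M_def F_def[symmetric] Q_def[symmetric] lyap_def
    by (simp add: eq_neg_iff_add_eq_0)
  have lyap_W: "lyapunov_W A B S L G W \<longleftrightarrow> lyap (transpose (F G)) W = - r G" for G W
    unfolding lyapunov_W_def F_def[symmetric] r_def[symmetric] lyap_def
    by (simp add: eq_neg_iff_add_eq_0)
  have stable_F: "stable (F G)" if "G \<in> stabilizing S L" for G
    using that assms(2) by (auto simp: F_def stabilizing_def intro: stable_block_diag)
  have ex1_M: "\<exists>!M. lyapunov_M A C CV S L G M" if "inj (lyap (F G))" for G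
    unfolding lyap_M by (rule ex1_linear_inj[OF linear_lyap that])
  have ex1_W: "\<exists>!W. lyapunov_W A B S L G W" if "inj (lyap (transpose (F G)))" for G
    unfolding lyap_W by (rule ex1_linear_inj[OF linear_lyap that])
  \<comment> \<open>The condition is injectivity instead of stability, as it is the property that
    passes to points near a stabilizing \<open>G\<close>.\<close>
  have sol_M: "lyap (F G) (sol_M A C CV S L G) = - Q" if "inj (lyap (F G))" for G
    using theI'[OF ex1_M[OF that]] by (simp add: sol_M_def lyap_M)
  have sol_W: "lyap (transpose (F G)) (sol_W A B S L G) = - r G" if "inj (lyap (transpose (F G)))" for G
    using theI'[OF ex1_W[OF that]] by (simp add: sol_W_def lyap_W)
  have objective: "objective A B C CV S L = (\<lambda>G. sol_M A C CV S L G \<bullet> r G)"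
  proof
    fix G
    have "objective A B C CV S L G = stack B G \<bullet> (sol_M A C CV S L G ** stack B G)"
      by (simp add: objective_def inner_eq_trace matrix_mul_assoc)
    also have "\<dots> = (sol_M A C CV S L G ** stack B G) \<bullet> stack B G"
      by (rule inner_commute)
    finally show "objective A B C CV S L G = sol_M A C CV S L G \<bullet> r G"
      by (simp add: r_def inner_matrix_mult_right)
  qed
  have gradient: "has_gradient (objective A B C CV S L)
        (2 *\<^sub>R (- (transpose (block12 M) ** block12 W ** transpose L)
                - block22 M ** block22 W ** transpose L
                + transpose (block12 M) ** B
                + block22 M ** G)) G"
    if G: "G \<in> stabilizing S L" and M_def: "M = sol_M A C CV S L G" and W_def: "W = sol_W A B S L G"
    for G M W
  proof -
    have inj: "inj (lyap (F G))" "inj (lyap (transpose (F G)))"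
      using stable_F[OF G] by (simp_all add: inj_lyap stable_transpose)
    have M: "lyap (F G) M = - Q" and W: "lyap (transpose (F G)) W = - r G"
      using sol_M sol_W inj by (auto simp: M_def W_def)
    have sym_M: "transpose M = M"
      by (rule lyap_symmetric[OF inj(1) M])
        (simp add: Q_def transpose_minus transpose_block_mat matrix_transpose_mul)
    have sym_W: "transpose W = W"
      by (rule lyap_symmetric[OF inj(2) W]) (simp add: r_def transpose_minus matrix_transpose_mul)
    have "bounded_bilinear (\<lambda>H. lyap (E H))"
      using bounded_bilinear.comp1[OF bounded_bilinear_lyap bounded_linear_perturbation]
      by (simp add: E_def)
    moreover have "lyap (F H) X = lyap (F G) X + lyap (E (H - G)) X" for H X
      unfolding F_def E_def block_mat_perturb[of A S H L G] lyap_add_left ..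
    moreover have "(r has_derivative
        (\<lambda>H. stack B G ** transpose (stack 0 H) + stack 0 H ** transpose (stack B G))) (at G)"
      unfolding r_def
      by (rule bounded_bilinear.FDERIV[OF bounded_bilinear_outer has_derivative_stack has_derivative_stack])
    \<comment> \<open>Hence \<open>- W\<close> is the adjoint state; the sign comes from the source
      term standing on the left in the equation for \<open>W\<close>.\<close>
    moreover have "lyap (F G) X \<bullet> (- W) = X \<bullet> r G" for X
      using W by (simp add: lyap_inner)
    ultimately have "(objective A B C CV S L has_derivative
       (\<lambda>H. M \<bullet> (stack B G ** transpose (stack 0 H) + stack 0 H ** transpose (stack B G))
          - lyap (E H) M \<bullet> (- W))) (at G)"
      unfolding objective M_def
      by (intro has_derivative_adjoint_state[where T = "\<lambda>G. lyap (F G)" and q = "- Q"]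
          linear_lyap inj(1) sol_M)
    moreover have "M \<bullet> (stack B G ** transpose (stack 0 H) + stack 0 H ** transpose (stack B G))
          - lyap (E H) M \<bullet> (- W) =
        (2 *\<^sub>R (- (transpose (block12 M) ** block12 W ** transpose L)
                - block22 M ** block22 W ** transpose L
                + transpose (block12 M) ** B
                + block22 M ** G)) \<bullet> H" (is "?l = ?N \<bullet> H") for H
    proof -
      have "M \<bullet> (stack 0 H ** transpose (stack B G)) = (M ** stack B G) \<bullet> stack 0 H"
        by (simp add: inner_matrix_mult_right)
      \<comment> \<open>The two summands in the derivative of \<open>r\<close> are transposes of
        each other and \<open>M\<close> is symmetric, so they contribute equally.\<close>
      moreover have "M \<bullet> (stack B G ** transpose (stack 0 H)) = M \<bullet> (stack 0 H ** transpose (stack B G))"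
        using inner_transpose[of M "stack 0 H ** transpose (stack B G)"]
        by (simp add: matrix_transpose_mul sym_M)
      \<comment> \<open>\<open>E H\<close> lives in the lower right block, so it sees only that
        block of \<open>M ** W\<close>; the factor \<open>L\<close> is then moved across the inner
        product.\<close>
      moreover have "E H \<bullet> (M ** W) = - ((block22 (M ** W) ** transpose L) \<bullet> H)"
        unfolding inner_commute[of _ H] inner_matrix_mult_right[symmetric]
        by (simp add: E_def block_mat_inner_lower)
      ultimately have "?l = 2 * ((transpose (block12 M) ** B + block22 M ** G) \<bullet> H)
          - 2 * ((block22 (M ** W) ** transpose L) \<bullet> H)"
        by (simp add: inner_add_right mult_stack_inner_stack_0[OF sym_M]
            lyap_inner_symmetric[OF sym_M sym_W])
      also have "\<dots> = ?N \<bullet> H"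
        by (simp add: block22_mult[OF sym_M] matrix_add_rdistrib inner_add_left inner_diff_left algebra_simps)
      finally show ?thesis .
    qed
    ultimately show ?thesis
      by (simp add: has_gradient_def inner_eq_trace)
  qed
  have "objective A B C CV S L differentiable (at G)" if "G \<in> stabilizing S L" for G
    using gradient[OF that refl refl] by (auto simp: has_gradient_def differentiable_def)
  with gradient ex1_M ex1_W stable_F show ?thesis
    by (auto simp: Let_def inj_lyap stable_transpose)
qed

end
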